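(* Let $(\Phi(z),\Psi(z))$ be a pair of jointly Gaussian $\mathcal{D}_0$-GAFs. Then \[ \big|\mathbb{E}\,\Phi(z)\overline{\Psi(w)}\big|+\big|\mathbb{E}\,\Phi(z)\Psi(w)\big|\le\bigg(\log\frac{1}{1-|z|^2}\bigg)^{\frac12}\bigg(\log\frac{1}{1-|w|^2}\bigg)^{\frac12},\qquad z,w\in\mathbb{D}. \]
   Context: $\mathbb{D}=\{z\in\mathbb{C}:|z|<1\}$. A Gaussian Hilbert space $\mathfrak{G}$ is a closed ($\mathbb{C}$-linear) subspace of $L^2(\Omega,dP)$, for a probability space $(\Omega,dP)$, each of whose elements has a complex Gaussian distribution with mean $0$ (real and imaginary parts are jointly Gaussian with mean $0$); $\mathfrak{G}$ is assumed conjugation-invariant ($\gamma\in\mathfrak{G}\iff\bar\gamma\in\mathfrak{G}$). $\mathbb{E}$ denotes expectation, $\mathbb{E}\gamma=\int_\Omega\gamma\,dP$. A standard complex Gaussian variable is a mean-zero complex Gaussian $\gamma$ with $\mathbb{E}(\gamma^2)=0$ and $\mathbb{E}(|\gamma|^2)=1$. A pair of jointly Gaussian $\mathcal{D}_0$-GAFs is a pair $(\Phi,\Psi)$ of random analytic functions on $\mathbb{D}$, \[ \Phi(z)=\sum_{j=1}^{+\infty}\frac{\alpha_j}{\sqrt{j}}\,z^j,\qquad \Psi(z)=\sum_{j=1}^{+\infty}\frac{\beta_j}{\sqrt{j}}\,z^j, \] where $\alpha_1,\alpha_2,\ldots$ are i.i.d. standard complex Gaussian variables, $\beta_1,\beta_2,\ldots$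 are i.i.d. standard complex Gaussian variables, and all the $\alpha_j$ and $\beta_j$ are taken from one and the same Gaussian Hilbert space $\mathfrak{G}$ (no assumption is made on the correlations between the $\alpha_j$ and the $\beta_k$). *)

theory Defs
  imports "HOL-Probability.Probability" "HOL-Complex_Analysis.Complex_Analysis"
begin

(* The degenerate law (variance 0) counts as Gaussian; it has no density, hence the separate case. *)
definition centered_real_gaussian :: "'a measure \<Rightarrow> ('a \<Rightarrow> real) \<Rightarrow> bool" where
  "centered_real_gaussian M X \<longleftrightarrow> X \<in> borel_measurable M \<and>
     ((AE \<omega> in M. X \<omega> = 0) \<or> (\<exists>\<sigma>>0. distributed M lborel X (normal_density 0 \<sigma>)))"

(* Real and imaginary parts are jointly Gaussian with mean 0:
   every real linear combination of them is a centered real Gaussian. *)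
definition centered_complex_gaussian :: "'a measure \<Rightarrow> ('a \<Rightarrow> complex) \<Rightarrow> bool" where
  "centered_complex_gaussian M \<gamma> \<longleftrightarrow> \<gamma> \<in> borel_measurable M \<and>
     (\<forall>a b :: real. centered_real_gaussian M (\<lambda>\<omega>. a * Re (\<gamma> \<omega>) + b * Im (\<gamma> \<omega>)))"

definition standard_complex_gaussian :: "'a measure \<Rightarrow> ('a \<Rightarrow> complex) \<Rightarrow> bool" where
  "standard_complex_gaussian M \<gamma> \<longleftrightarrow> centered_complex_gaussian M \<gamma> \<and>
     (LINT \<omega>|M. (\<gamma> \<omega>)\<^sup>2) = 0 \<and> (LINT \<omega>|M. (cmod (\<gamma> \<omega>))\<^sup>2) = 1"

definition square_integrable :: "'a measure \<Rightarrow> ('a \<Rightarrow> complex) \<Rightarrow> bool" where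
  "square_integrable M f \<longleftrightarrow> f \<in> borel_measurable M \<and> integrable M (\<lambda>\<omega>. (cmod (f \<omega>))\<^sup>2)"

(* Elements of the L2 space are represented by functions instead of classes modulo almost everywhere
   equality.  The closedness clause (applied to constant sequences) makes G contain
   every square integrable function that agrees almost everywhere with one of its elements. *)
definition gaussian_hilbert_space :: "'a measure \<Rightarrow> ('a \<Rightarrow> complex) set \<Rightarrow> bool" where
  "gaussian_hilbert_space M G \<longleftrightarrow> prob_space M \<and>
     (\<forall>f\<in>G. square_integrable M f) \<and>
     (\<lambda>\<omega>. 0) \<in> G \<and>
     (\<forall>f\<in>G. \<forall>g\<in>G. (\<lambda>\<omega>. f \<omega> + g \<omega>) \<in> G) \<and>
     (\<forall>c. \<forall>f\<in>G. (\<lambda>\<omega>. c * f \<omega>) \<in> G) \<and>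
     (\<forall>F f. (\<forall>n. F n \<in> G) \<and> square_integrable M f \<and>
        (\<lambda>n::nat. LINT \<omega>|M. (cmod (F n \<omega> - f \<omega>))\<^sup>2) \<longlonglongrightarrow> 0 \<longrightarrow> f \<in> G) \<and>
     (\<forall>f\<in>G. centered_complex_gaussian M f) \<and>
     (\<forall>f. f \<in> G \<longleftrightarrow> (\<lambda>\<omega>. cnj (f \<omega>)) \<in> G)"

definition random_analytic_function :: "'a measure \<Rightarrow> complex set \<Rightarrow> (complex \<Rightarrow> 'a \<Rightarrow> complex) \<Rightarrow> bool" where
  "random_analytic_function M S \<Phi> \<longleftrightarrow> (\<forall>z\<in>S. \<Phi> z \<in> borel_measurable M) \<and>
     (AE \<omega> in M. (\<lambda>z. \<Phi> z \<omega>) analytic_on S)"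

(* Standard complex Gaussians all have the same law, so only independence has to be required
   of the coefficients.  As usual, the series represents the random function almost surely. *)
definition D0_GAF :: "'a measure \<Rightarrow> ('a \<Rightarrow> complex) set \<Rightarrow> (complex \<Rightarrow> 'a \<Rightarrow> complex) \<Rightarrow> bool" where
  "D0_GAF M G \<Phi> \<longleftrightarrow> random_analytic_function M (ball 0 1) \<Phi> \<and>
     (\<exists>\<alpha> :: nat \<Rightarrow> 'a \<Rightarrow> complex.
        (\<forall>j\<ge>1. \<alpha> j \<in> G \<and> standard_complex_gaussian M (\<alpha> j)) \<and>
        prob_space.indep_vars M (\<lambda>_. borel) \<alpha> {1..} \<and>
        (AE \<omega> in M. \<forall>z\<in>ball 0 1.
           (\<lambda>j. \<alpha> (Suc j) \<omega> / complex_of_real (sqrt (real (Suc j))) * z ^ Suc j) sums \<Phi> z \<omega>))"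

(* No condition links the coefficients of the two functions, beyond their lying in the same G. *)
definition jointly_gaussian_D0_GAFs ::
  "'a measure \<Rightarrow> ('a \<Rightarrow> complex) set \<Rightarrow> (complex \<Rightarrow> 'a \<Rightarrow> complex) \<Rightarrow> (complex \<Rightarrow> 'a \<Rightarrow> complex) \<Rightarrow> bool" where
  "jointly_gaussian_D0_GAFs M G \<Phi> \<Psi> \<longleftrightarrow>
     gaussian_hilbert_space M G \<and> D0_GAF M G \<Phi> \<and> D0_GAF M G \<Psi>"

end

theory Submission
  imports Defs
begin

text \<open>
  Multiplying \<open>X = \<Phi>(z)\<close> and \<open>Y = \<Psi>(w)\<close> by suitable unimodular constants makes both
  \<open>E X cnj(Y)\<close> and \<open>E X Y\<close> nonnegative, and then their sum is \<open>2 E Re(X) Re(Y)\<close>.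
  The pseudovariance of \<open>X\<close> vanishes, so that \<open>Re(c X)\<close> carries only half of the variance of
  \<open>X\<close> for every unimodular \<open>c\<close>; the Cauchy-Schwarz inequality therefore absorbs the factor 2.
  The bound on the variance comes from the partial sums by Fatou's lemma.
\<close>

section \<open>Square-integrable functions and the Cauchy-Schwarz inequality\<close>

lemma integrable_mult_of_squares:
  fixes U V :: "'a \<Rightarrow> real"
  assumes [measurable]: "U \<in> borel_measurable M" "V \<in> borel_measurable M"
    and U: "integrable M (\<lambda>x. (U x)\<^sup>2)" and V: "integrable M (\<lambda>x. (V x)\<^sup>2)"
  shows "integrable M (\<lambda>x. U x * V x)"
proof (rule Bochner_Integration.integrable_bound[OF Bochner_Integration.integrable_add[OF U V]])
  have "\<bar>u * v\<bar> \<le> u\<^sup>2 + v\<^sup>2" for u v :: real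
    using sum_squares_bound[of "\<bar>u\<bar>" "\<bar>v\<bar>"] mult_nonneg_nonneg[of "\<bar>u\<bar>" "\<bar>v\<bar>"]
    unfolding abs_mult power2_abs by linarith
  then show "AE x in M. norm (U x * V x) \<le> norm ((U x)\<^sup>2 + (V x)\<^sup>2)"
    by simp
qed simp

lemma Cauchy_Schwarz_integral_real:
  fixes U V :: "'a \<Rightarrow> real"
  assumes [measurable]: "U \<in> borel_measurable M" "V \<in> borel_measurable M"
    and U: "integrable M (\<lambda>x. (U x)\<^sup>2)" and V: "integrable M (\<lambda>x. (V x)\<^sup>2)"
  shows "(LINT x|M. U x * V x)\<^sup>2 \<le> (LINT x|M. (U x)\<^sup>2) * (LINT x|M. (V x)\<^sup>2)"
proof -
  define a b c where "a = (LINT x|M. (U x)\<^sup>2)" and "b = (LINT x|M. U x * V x)"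
    and "c = (LINT x|M. (V x)\<^sup>2)"
  have UV: "integrable M (\<lambda>x. U x * V x)"
    by (rule integrable_mult_of_squares) (use U V in auto)
  have "a \<ge> 0" unfolding a_def by simp
  show ?thesis
  proof (cases "a = 0")
    case True
    then have "AE x in M. (U x)\<^sup>2 = 0"
      using integral_nonneg_eq_0_iff_AE[OF U] by (simp add: a_def)
    then have "AE x in M. U x * V x = 0" by auto
    then have "b = 0" unfolding b_def by (rule integral_eq_zero_AE)
    then show ?thesis using True by (simp add: a_def b_def)
  next
    case False
    \<comment> \<open>The integrand is the square of \<open>a\<close> times the component of
      \<open>V\<close> orthogonal to \<open>U\<close> in L2. Scaling by \<open>a\<close> avoids the
      quotient \<open>b / a\<close>; the factor \<open>a > 0\<close> is cancelled at the
      end.\<close>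
    have "0 \<le> (LINT x|M. (a * V x - b * U x)\<^sup>2)" by simp
    also have "\<dots> = (LINT x|M. a\<^sup>2 * (V x)\<^sup>2 - 2 * a * b * (U x * V x) + b\<^sup>2 * (U x)\<^sup>2)"
      by (rule Bochner_Integration.integral_cong) (auto simp: power2_eq_square algebra_simps)
    also have "\<dots> = a\<^sup>2 * c - 2 * a * b * b + b\<^sup>2 * a"
      using U V UV by (simp add: a_def b_def c_def)
    also have "\<dots> = a * (a * c - b\<^sup>2)"
      by (simp add: power2_eq_square algebra_simps)
    finally have "b\<^sup>2 \<le> a * c"
      using False \<open>a \<ge> 0\<close> by (auto simp: zero_le_mult_iff)
    then show ?thesis by (simp add: a_def b_def c_def)
  qed
qed

lemma square_integrable_of_Re_Im:
  assumes [measurable]: "X \<in> borel_measurable M"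
    and Re: "integrable M (\<lambda>x. (Re (X x))\<^sup>2)" and Im: "integrable M (\<lambda>x. (Im (X x))\<^sup>2)"
  shows "square_integrable M X"
  using Bochner_Integration.integrable_add[OF Re Im]
  by (simp add: square_integrable_def cmod_power2)

lemma square_integrable_integrable_mult:
  assumes "square_integrable M X" "square_integrable M Y"
  shows "integrable M (\<lambda>x. X x * Y x)"
proof (rule Bochner_Integration.integrable_bound[where f = "\<lambda>x. cmod (X x) * cmod (Y x)"])
  show "integrable M (\<lambda>x. cmod (X x) * cmod (Y x))"
    using assms by (intro integrable_mult_of_squares) (auto simp: square_integrable_def)
  show "(\<lambda>x. X x * Y x) \<in> borel_measurable M"
    using assms by (auto simp: square_integrable_def)
qed (simp add: norm_mult)

lemma square_integrable_Re_mult: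
  assumes "square_integrable M X"
  shows "integrable M (\<lambda>x. (Re (c * X x))\<^sup>2)"
proof (rule Bochner_Integration.integrable_bound[where f = "\<lambda>x. (cmod c)\<^sup>2 * (cmod (X x))\<^sup>2"])
  show "integrable M (\<lambda>x. (cmod c)\<^sup>2 * (cmod (X x))\<^sup>2)"
    using assms by (simp add: square_integrable_def)
  show "(\<lambda>x. (Re (c * X x))\<^sup>2) \<in> borel_measurable M"
    using assms by (auto simp: square_integrable_def)
  have "(Re (c * X x))\<^sup>2 \<le> (cmod c)\<^sup>2 * (cmod (X x))\<^sup>2" for x
    using power_mono[OF abs_Re_le_cmod[of "c * X x"], of 2]
    by (simp add: norm_mult power_mult_distrib)
  then show "AE x in M. norm ((Re (c * X x))\<^sup>2) \<le> norm ((cmod c)\<^sup>2 * (cmod (X x))\<^sup>2)"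
    by simp
qed

text \<open>The variance bounds are required in every direction \<open>c\<close> because the
  rotations used in the proof depend on the two expectations to be estimated. The halves in them
  compensate for the factor 2 in front of the expectation of the product of real parts.\<close>

lemma covariance_pseudocovariance_bound:
  fixes X Y :: "'a \<Rightarrow> complex"
  assumes X: "square_integrable M X" and Y: "square_integrable M Y"
    and A: "\<And>c. cmod c = 1 \<Longrightarrow> (LINT x|M. (Re (c * X x))\<^sup>2) \<le> A / 2"
    and B: "\<And>c. cmod c = 1 \<Longrightarrow> (LINT x|M. (Re (c * Y x))\<^sup>2) \<le> B / 2"
  shows "cmod (LINT x|M. X x * cnj (Y x)) + cmod (LINT x|M. X x * Y x) \<le> sqrt A * sqrt B"
proof -
  have meas[measurable]: "X \<in> borel_measurable M" "Y \<in> borel_measurable M"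
    using X Y by (auto simp: square_integrable_def)
  have cnjY: "square_integrable M (\<lambda>x. cnj (Y x))"
    using Y by (auto simp: square_integrable_def
        intro!: borel_measurable_continuous_on[where f = cnj] continuous_intros)
  define P Q where "P = (LINT x|M. X x * cnj (Y x))" and "Q = (LINT x|M. X x * Y x)"
  \<comment> \<open>The arguments of \<open>c\<close> and \<open>d\<close> solve arg c - arg d =
    -Arg P and arg c + arg d = -Arg Q, so that both rotated expectations become their moduli. The
    value chosen for the argument of 0 is harmless, so neither \<open>P = 0\<close> nor
    \<open>Q = 0\<close> needs a separate case.\<close>
  define c d where "c = cis (- (Arg P + Arg Q) / 2)" and "d = cis ((Arg P - Arg Q) / 2)"
  have norm: "cmod c = 1" "cmod d = 1" by (auto simp: c_def d_def)
  have "c * cnj d = cis (- Arg P)" "c * d = cis (- Arg Q)"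
    by (simp_all add: c_def d_def cis_cnj cis_mult field_simps)
  then have rot: "c * cnj d * P = cmod P" "c * d * Q = cmod Q"
    using rcis_cmod_Arg[of P] rcis_cmod_Arg[of Q]
    by (metis (no_types, opaque_lifting) cis_mult cis_zero rcis_def mult.left_commute mult.right_neutral add.left_inverse)+
  let ?U = "\<lambda>x. Re (c * X x)" and ?V = "\<lambda>x. Re (d * Y x)"
  have int: "integrable M (\<lambda>x. X x * cnj (Y x))" "integrable M (\<lambda>x. X x * Y x)"
    using X Y cnjY by (auto intro: square_integrable_integrable_mult)
  have U: "integrable M (\<lambda>x. (?U x)\<^sup>2)" and V: "integrable M (\<lambda>x. (?V x)\<^sup>2)"
    by (rule square_integrable_Re_mult, fact)+
  have "cmod P + cmod Q = Re (c * cnj d * P + c * d * Q)"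
    by (simp only: rot Re_complex_of_real plus_complex.sel)
  also have "c * cnj d * P + c * d * Q
      = (LINT x|M. c * cnj d * (X x * cnj (Y x)) + c * d * (X x * Y x))"
    unfolding P_def Q_def using int by simp
  also have "Re \<dots> = (LINT x|M. Re (c * cnj d * (X x * cnj (Y x)) + c * d * (X x * Y x)))"
    using int by (intro integral_Re[symmetric]) auto
  \<comment> \<open>With x = c X and y = d Y the integrand is the real part of x (cnj y + y) = 2 x
    Re y.\<close>
  also have "\<dots> = (LINT x|M. 2 * (?U x * ?V x))"
    by (rule Bochner_Integration.integral_cong) (auto simp: algebra_simps)
  also have "\<dots> = 2 * (LINT x|M. ?U x * ?V x)" by simp
  finally have eq: "cmod P + cmod Q = 2 * (LINT x|M. ?U x * ?V x)" .
  have "(cmod P + cmod Q)\<^sup>2 = 4 * (LINT x|M. ?U x * ?V x)\<^sup>2"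
    by (simp add: eq power_mult_distrib)
  also have "\<dots> \<le> 4 * ((LINT x|M. (?U x)\<^sup>2) * (LINT x|M. (?V x)\<^sup>2))"
    using U V by (intro mult_left_mono Cauchy_Schwarz_integral_real) auto
  also have "\<dots> \<le> 4 * (A / 2 * (B / 2))"
  proof (intro mult_left_mono mult_mono A B norm)
    have "0 \<le> (LINT x|M. (?U x)\<^sup>2)" by simp
    then show "0 \<le> A / 2" using A[OF norm(1)] by linarith
  qed simp_all
  finally have "(cmod P + cmod Q)\<^sup>2 \<le> A * B" by simp
  then have "cmod P + cmod Q \<le> sqrt (A * B)" by (rule real_le_rsqrt)
  then show ?thesis by (simp add: P_def Q_def real_sqrt_mult)
qed

section \<open>Second moments of independent sums and of standard complex Gaussians\<close>

lemma (in prob_space) centered_real_gaussian_expectation: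
  assumes "centered_real_gaussian M X"
  shows "expectation X = 0"
  using assms normal_distributed_expectation[of _ X 0]
  by (auto simp: centered_real_gaussian_def intro: integral_eq_zero_AE)

text \<open>This is Pythagoras in L2: by independence the expectation of a mixed product factors
  into two means, both 0, so only the diagonal of the expanded square survives.\<close>

lemma (in prob_space) expectation_sum_squared_indep_centered:
  fixes U :: "'i \<Rightarrow> 'a \<Rightarrow> real"
  assumes "finite I" and indep: "indep_vars (\<lambda>_. borel) U I"
    and sq: "\<And>i. i \<in> I \<Longrightarrow> integrable M (\<lambda>x. (U i x)\<^sup>2)"
    and mean: "\<And>i. i \<in> I \<Longrightarrow> expectation (U i) = 0"
  shows "integrable M (\<lambda>x. (\<Sum>i\<in>I. U i x)\<^sup>2)"
    and "expectation (\<lambda>x. (\<Sum>i\<in>I. U i x)\<^sup>2) = (\<Sum>i\<in>I. expectation (\<lambda>x. (U i x)\<^sup>2))"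
proof -
  have [measurable]: "U i \<in> borel_measurable M" if "i \<in> I" for i
    using indep that by (auto simp: indep_vars_def)
  have int: "integrable M (\<lambda>x. U i x * U j x)" if "i \<in> I" "j \<in> I" for i j
    by (rule integrable_mult_of_squares) (use that sq in auto)
  have orth: "expectation (\<lambda>x. U i x * U j x) = 0" if ij: "i \<in> I" "j \<in> I" "i \<noteq> j" for i j
  proof -
    have "expectation (\<lambda>x. \<Prod>k\<in>{i, j}. U k x) = (\<Prod>k\<in>{i, j}. expectation (U k))"
      using ij sq by (intro indep_vars_lebesgue_integral indep_vars_subset[OF indep])
        (auto intro: square_integrable_imp_integrable)
    then show ?thesis using ij mean by simp
  qed
  have sq_sum: "(\<Sum>i\<in>I. U i x)\<^sup>2 = (\<Sum>i\<in>I. \<Sum>j\<in>I. U i x * U j x)" for x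
    by (simp add: power2_eq_square sum_product)
  show "integrable M (\<lambda>x. (\<Sum>i\<in>I. U i x)\<^sup>2)"
    unfolding sq_sum using int by auto
  have "expectation (\<lambda>x. (\<Sum>i\<in>I. U i x)\<^sup>2) = (\<Sum>i\<in>I. \<Sum>j\<in>I. expectation (\<lambda>x. U i x * U j x))"
    unfolding sq_sum using int by simp
  also have "\<dots> = (\<Sum>i\<in>I. \<Sum>j\<in>I. if j = i then expectation (\<lambda>x. (U i x)\<^sup>2) else 0)"
    by (intro sum.cong refl) (auto simp: orth power2_eq_square)
  also have "\<dots> = (\<Sum>i\<in>I. expectation (\<lambda>x. (U i x)\<^sup>2))"
    using \<open>finite I\<close> by simp
  finally show "expectation (\<lambda>x. (\<Sum>i\<in>I. U i x)\<^sup>2) = (\<Sum>i\<in>I. expectation (\<lambda>x. (U i x)\<^sup>2))" .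
qed

text \<open>The variance rests on (Re u)^2 = (|u|^2 + Re(u^2)) / 2 with u = c \<gamma>. The last
  term has mean 0, since multiplication by \<open>c\<close> only scales the vanishing pseudovariance
  by c^2. Hence the result depends on the modulus of \<open>c\<close> alone.\<close>

lemma (in prob_space) standard_complex_gaussian_Re_mult:
  assumes \<gamma>: "standard_complex_gaussian M \<gamma>"
  shows "expectation (\<lambda>x. Re (c * \<gamma> x)) = 0"
    and "integrable M (\<lambda>x. (Re (c * \<gamma> x))\<^sup>2)"
    and "expectation (\<lambda>x. (Re (c * \<gamma> x))\<^sup>2) = (cmod c)\<^sup>2 / 2"
proof -
  have meas[measurable]: "\<gamma> \<in> borel_measurable M"
    using \<gamma> by (auto simp: standard_complex_gaussian_def centered_complex_gaussian_def)
  have "centered_real_gaussian M (\<lambda>x. Re c * Re (\<gamma> x) + (- Im c) * Im (\<gamma> x))"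
    using \<gamma> unfolding standard_complex_gaussian_def centered_complex_gaussian_def by blast
  then show "expectation (\<lambda>x. Re (c * \<gamma> x)) = 0"
    by (auto dest: centered_real_gaussian_expectation)
  have norm: "expectation (\<lambda>x. (cmod (\<gamma> x))\<^sup>2) = 1"
    using \<gamma> by (simp add: standard_complex_gaussian_def)
  \<comment> \<open>The integral of a non-integrable function is 0 by convention, so the value 1
    forces integrability.\<close>
  then have int_norm: "integrable M (\<lambda>x. (cmod (\<gamma> x))\<^sup>2)"
    using not_integrable_integral_eq by fastforce
  then have sq: "square_integrable M \<gamma>" by (simp add: square_integrable_def)
  then show "integrable M (\<lambda>x. (Re (c * \<gamma> x))\<^sup>2)" by (rule square_integrable_Re_mult)
  have int_sq: "integrable M (\<lambda>x. (\<gamma> x)\<^sup>2)"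
    using square_integrable_integrable_mult[OF sq sq] by (simp add: power2_eq_square)
  have Re_sq: "(Re u)\<^sup>2 = ((cmod u)\<^sup>2 + Re (u\<^sup>2)) / 2" for u
    unfolding cmod_power2 by (simp add: power2_eq_square)
  have "expectation (\<lambda>x. (Re (c * \<gamma> x))\<^sup>2)
      = expectation (\<lambda>x. ((cmod c)\<^sup>2 * (cmod (\<gamma> x))\<^sup>2 + Re (c\<^sup>2 * (\<gamma> x)\<^sup>2)) / 2)"
    unfolding Re_sq norm_mult power_mult_distrib ..
  also have "\<dots> = ((cmod c)\<^sup>2 * expectation (\<lambda>x. (cmod (\<gamma> x))\<^sup>2)
      + expectation (\<lambda>x. Re (c\<^sup>2 * (\<gamma> x)\<^sup>2))) / 2"
    using int_norm int_sq by (simp del: times_complex.sel)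
  also have "expectation (\<lambda>x. Re (c\<^sup>2 * (\<gamma> x)\<^sup>2)) = Re (c\<^sup>2 * (LINT x|M. (\<gamma> x)\<^sup>2))"
    using int_sq by (subst integral_Re) (auto simp del: times_complex.sel)
  also have "(LINT x|M. (\<gamma> x)\<^sup>2) = 0"
    using \<gamma> by (simp add: standard_complex_gaussian_def)
  finally show "expectation (\<lambda>x. (Re (c * \<gamma> x))\<^sup>2) = (cmod c)\<^sup>2 / 2"
    by (simp add: norm)
qed

section \<open>The logarithmic bound on the variance of a GAF\<close>

lemma sum_power_divide_le_ln:
  fixes r :: real
  assumes "0 \<le> r" "r < 1"
  shows "(\<Sum>j<n. r ^ Suc j / real (Suc j)) \<le> ln (1 / (1 - r))"
proof -
  have "(\<lambda>n. - ((- (- r)) ^ n) / real n) sums ln (1 + (- r))"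
    using assms by (intro ln_series') auto
  then have "(\<lambda>n. r ^ n / real n) sums - ln (1 - r)"
    using sums_minus by fastforce
  \<comment> \<open>The shift leaves the sum unchanged: the dropped term at index 0 is
    \<open>1 / 0\<close>, which is 0 by convention.\<close>
  then have "(\<lambda>n. r ^ Suc n / real (Suc n)) sums - ln (1 - r)"
    by (subst sums_Suc_iff) simp
  then have "(\<Sum>j<n. r ^ Suc j / real (Suc j)) \<le> - ln (1 - r)"
    using sum_le_suminf[of "\<lambda>n. r ^ Suc n / real (Suc n)" "{..<n}"] assms
    by (simp add: sums_iff)
  then show ?thesis using assms by (simp add: ln_div)
qed

text \<open>Only an upper bound on the limit is wanted, so almost sure convergence with uniformly
  bounded second moments suffices, and convergence in L2 need not be established.\<close>

lemma Fatou_square_bound: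
  fixes S :: "nat \<Rightarrow> 'a \<Rightarrow> real" and X :: "'a \<Rightarrow> real"
  assumes [measurable]: "X \<in> borel_measurable M" "\<And>n. S n \<in> borel_measurable M"
    and lim: "AE x in M. (\<lambda>n. S n x) \<longlonglongrightarrow> X x"
    and int: "\<And>n. integrable M (\<lambda>x. (S n x)\<^sup>2)"
    and bound: "\<And>n. (LINT x|M. (S n x)\<^sup>2) \<le> C"
  shows "integrable M (\<lambda>x. (X x)\<^sup>2)" and "(LINT x|M. (X x)\<^sup>2) \<le> C"
proof -
  \<comment> \<open>The sign of \<open>C\<close> matters when returning from \<open>ennreal\<close>
    to the reals, because \<open>ennreal\<close> sends negative numbers to 0.\<close>
  have "0 \<le> (LINT x|M. (S 0 x)\<^sup>2)" by simp
  then have "0 \<le> C" using bound[of 0] by linarith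
  have "(\<integral>\<^sup>+x. ennreal ((X x)\<^sup>2) \<partial>M) = (\<integral>\<^sup>+x. liminf (\<lambda>n. ennreal ((S n x)\<^sup>2)) \<partial>M)"
  proof (rule nn_integral_cong_AE)
    show "AE x in M. ennreal ((X x)\<^sup>2) = liminf (\<lambda>n. ennreal ((S n x)\<^sup>2))"
      using lim
    proof eventually_elim
      case (elim x)
      then have "(\<lambda>n. ennreal ((S n x)\<^sup>2)) \<longlonglongrightarrow> ennreal ((X x)\<^sup>2)"
        by (intro tendsto_ennrealI tendsto_power)
      from lim_imp_Liminf[OF sequentially_bot this] show ?case by (rule sym)
    qed
  qed
  also have "\<dots> \<le> liminf (\<lambda>n. \<integral>\<^sup>+x. ennreal ((S n x)\<^sup>2) \<partial>M)"
    by (rule nn_integral_liminf) simp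
  also have "\<dots> = liminf (\<lambda>n. ennreal (LINT x|M. (S n x)\<^sup>2))"
    using int by (simp add: nn_integral_eq_integral)
  also have "\<dots> \<le> ennreal C"
    using bound by (intro Liminf_le) (auto simp: ennreal_leI)
  finally have le: "(\<integral>\<^sup>+x. ennreal ((X x)\<^sup>2) \<partial>M) \<le> ennreal C" .
  then show "integrable M (\<lambda>x. (X x)\<^sup>2)"
    by (intro integrableI_bounded) (auto intro: le_less_trans)
  then show "(LINT x|M. (X x)\<^sup>2) \<le> C"
    using le \<open>0 \<le> C\<close> by (simp add: nn_integral_eq_integral)
qed

text \<open>The real parts of the rotated terms are independent and centered, with variances
  |z|^(2j) / (2j) in which \<open>c\<close> no longer appears. Partial sums of these variances stay
  below half the logarithm, and Fatou carries the bound over to the sum of the series.\<close>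

lemma (in prob_space) D0_GAF_Re_mult:
  assumes "D0_GAF M G \<Phi>" and z: "z \<in> ball 0 1" and c: "cmod c = 1"
  shows "integrable M (\<lambda>x. (Re (c * \<Phi> z x))\<^sup>2)"
    and "expectation (\<lambda>x. (Re (c * \<Phi> z x))\<^sup>2) \<le> ln (1 / (1 - (cmod z)\<^sup>2)) / 2"
proof -
  obtain \<alpha> where \<alpha>: "\<And>j. j \<ge> 1 \<Longrightarrow> standard_complex_gaussian M (\<alpha> j)"
    and indep: "indep_vars (\<lambda>_. borel) \<alpha> {1::nat..}"
    and series: "AE x in M. \<forall>z\<in>ball 0 1.
      (\<lambda>j. \<alpha> (Suc j) x / complex_of_real (sqrt (real (Suc j))) * z ^ Suc j) sums \<Phi> z x"
    using assms(1) unfolding D0_GAF_def by blast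
  have [measurable]: "\<Phi> z \<in> borel_measurable M"
    using assms(1) z unfolding D0_GAF_def random_analytic_function_def by blast
  \<comment> \<open>Absorbing \<open>c\<close>, the power of \<open>z\<close> and the normalization
    into one deterministic factor makes each \<open>U j\<close> a measurable function of
    \<open>\<alpha> j\<close> alone, so independence is inherited.\<close>
  define b where "b j = c * z ^ j / complex_of_real (sqrt (real j))" for j
  define U where "U j x = Re (b j * \<alpha> j x)" for j x
  define S where "S n x = (\<Sum>j\<in>{1..n}. U j x)" for n x
  have indepU: "indep_vars (\<lambda>_. borel) U {1..n}" for n
    unfolding U_def
    by (rule indep_vars_compose2[OF indep_vars_subset[OF indep], where Y = "\<lambda>j u. Re (b j * u)"]) auto
  have meanU: "expectation (U j) = 0" and intU: "integrable M (\<lambda>x. (U j x)\<^sup>2)"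
    and varU: "expectation (\<lambda>x. (U j x)\<^sup>2) = ((cmod z)\<^sup>2) ^ j / real j / 2"
    if "j \<ge> 1" for j
  proof -
    note moments = standard_complex_gaussian_Re_mult[OF \<alpha>[OF that], of "b j"]
    have "(cmod (b j))\<^sup>2 = ((cmod z)\<^sup>2) ^ j / real j"
      using c by (simp add: b_def norm_divide norm_mult norm_power power_divide mult.commute
          flip: power_mult)
    then show "expectation (U j) = 0" and "integrable M (\<lambda>x. (U j x)\<^sup>2)"
      and "expectation (\<lambda>x. (U j x)\<^sup>2) = ((cmod z)\<^sup>2) ^ j / real j / 2"
      using moments unfolding U_def by simp_all
  qed
  have [measurable]: "S n \<in> borel_measurable M" for n
    unfolding S_def using indepU[of n] by (intro borel_measurable_sum) (auto simp: indep_vars_def)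
  have lim: "AE x in M. (\<lambda>n. S n x) \<longlonglongrightarrow> Re (c * \<Phi> z x)"
    using series
  proof eventually_elim
    case (elim x)
    then have "(\<lambda>j. c * (\<alpha> (Suc j) x / complex_of_real (sqrt (real (Suc j))) * z ^ Suc j))
        sums (c * \<Phi> z x)"
      using z by (intro sums_mult) auto
    then have "(\<lambda>j. U (Suc j) x) sums Re (c * \<Phi> z x)"
      by (auto dest!: sums_Re simp: U_def b_def algebra_simps simp del: times_complex.sel)
    \<comment> \<open>The series is indexed from 0 through \<open>Suc\<close>, while
      \<open>S\<close> runs over \<open>{1..n}\<close> to match the index set of the independence
      assumption; the two partial sums agree after reindexing.\<close>
    then show ?case
      by (simp add: sums_def S_def sum.atLeast1_atMost_eq del: times_complex.sel)
  qed
  have int: "integrable M (\<lambda>x. (S n x)\<^sup>2)" for n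
    unfolding S_def by (rule expectation_sum_squared_indep_centered) (use indepU meanU intU in auto)
  have bound: "expectation (\<lambda>x. (S n x)\<^sup>2) \<le> ln (1 / (1 - (cmod z)\<^sup>2)) / 2" for n
  proof -
    have "expectation (\<lambda>x. (S n x)\<^sup>2) = (\<Sum>j\<in>{1..n}. expectation (\<lambda>x. (U j x)\<^sup>2))"
      unfolding S_def
      by (rule expectation_sum_squared_indep_centered) (use indepU meanU intU in auto)
    also have "\<dots> = (\<Sum>j\<in>{1..n}. ((cmod z)\<^sup>2) ^ j / real j) / 2"
      by (simp add: varU sum_divide_distrib)
    also have "(\<Sum>j\<in>{1..n}. ((cmod z)\<^sup>2) ^ j / real j)
        = (\<Sum>j<n. ((cmod z)\<^sup>2) ^ Suc j / real (Suc j))"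
      by (simp add: sum.atLeast1_atMost_eq)
    also have "\<dots> \<le> ln (1 / (1 - (cmod z)\<^sup>2))"
      using z by (intro sum_power_divide_le_ln) (auto simp: abs_square_less_1)
    finally show ?thesis by simp
  qed
  show "integrable M (\<lambda>x. (Re (c * \<Phi> z x))\<^sup>2)"
    and "expectation (\<lambda>x. (Re (c * \<Phi> z x))\<^sup>2) \<le> ln (1 / (1 - (cmod z)\<^sup>2)) / 2"
    by (rule Fatou_square_bound[OF _ _ lim int bound]; measurable)+
qed

lemma (in prob_space) D0_GAF_square_integrable:
  assumes "D0_GAF M G \<Phi>" "z \<in> ball 0 1"
  shows "square_integrable M (\<Phi> z)"
proof (rule square_integrable_of_Re_Im)
  show "\<Phi> z \<in> borel_measurable M"
    using assms unfolding D0_GAF_def random_analytic_function_def by blast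
  show "integrable M (\<lambda>x. (Re (\<Phi> z x))\<^sup>2)"
    using D0_GAF_Re_mult(1)[OF assms, of 1] by simp
  \<comment> \<open>Rotation by the imaginary unit turns the imaginary part, up to sign, into a real
    part.\<close>
  show "integrable M (\<lambda>x. (Im (\<Phi> z x))\<^sup>2)"
    using D0_GAF_Re_mult(1)[OF assms, of \<i>] by simp
qed

theorem proposition1p5p1:
  fixes M :: "'a measure" and G :: "('a \<Rightarrow> complex) set"
    and \<Phi> \<Psi> :: "complex \<Rightarrow> 'a \<Rightarrow> complex" and z w :: complex
  assumes "jointly_gaussian_D0_GAFs M G \<Phi> \<Psi>"
    and "z \<in> ball 0 1" and "w \<in> ball 0 1"
  shows "cmod (LINT \<omega>|M. \<Phi> z \<omega> * cnj (\<Psi> w \<omega>)) + cmod (LINT \<omega>|M. \<Phi> z \<omega> * \<Psi> w \<omega>)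
    \<le> sqrt (ln (1 / (1 - (cmod z)\<^sup>2))) * sqrt (ln (1 / (1 - (cmod w)\<^sup>2)))"
proof -
  interpret prob_space M
    using assms(1) by (simp add: jointly_gaussian_D0_GAFs_def gaussian_hilbert_space_def)
  have "D0_GAF M G \<Phi>" "D0_GAF M G \<Psi>"
    using assms(1) by (simp_all add: jointly_gaussian_D0_GAFs_def)
  then show ?thesis
    using assms(2,3)
    by (intro covariance_pseudocovariance_bound D0_GAF_square_integrable D0_GAF_Re_mult(2))
qed

end
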